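(* Let $p\in[0,1/2)$ be a fixed constant (independent of $n$). Then, asymptotically almost surely (i.e., with probability tending to $1$ as $n\to\infty$), the random graph $G\sim G(n,p)$ has the property that every orientation of $G$ contains a Seymour vertex.
   Context: $G(n,p)$ denotes the binomial random graph on $n$ vertices in which each of the $\binom{n}{2}$ possible edges is present independently with probability $p$. An orientation of a (finite, simple) graph assigns a direction to each edge, giving an oriented graph. For a digraph $D$ and $v\in V(D)$, the outneighbourhood is $N_1(v)=\{w\in V(D)\setminus\{v\}: vw\in E(D)\}$, and the second outneighbourhood is $N_2(v)=\{w\in V(D)\setminus(\{v\}\cup N_1(v)): \text{there is an edge from some vertex of } N_1(v) \text{ to } w\}$. A vertex $v$ is a Seymour vertex if $|N_2(v)|\ge |N_1(v)|$. *)

theory Defs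
  imports "HOL-Probability.Probability"
begin

text \<open>Undirected edges are two-element sets of vertices; directed edges are ordered pairs.\<close>

definition complete_edges :: "'a set \<Rightarrow> 'a set set" where
  "complete_edges V = {e. e \<subseteq> V \<and> card e = 2}"

text \<open>The binomial random graph on the vertex set \<open>{..<n}\<close>, as a distribution on edge sets.
  The value \<open>False\<close> is only the default of the product outside the potential edges.\<close>

definition gnp :: "nat \<Rightarrow> real \<Rightarrow> nat set set pmf" where
  "gnp n p = map_pmf (\<lambda>f. {e \<in> complete_edges {..<n}. f e})
     (Pi_pmf (complete_edges {..<n}) False (\<lambda>_. bernoulli_pmf p))"

definition orientation_of :: "'a set set \<Rightarrow> ('a \<times> 'a) set \<Rightarrow> bool" where
  "orientation_of E A \<longleftrightarrow>
     (\<forall>u v. (u, v) \<in> A \<longrightarrow> {u, v} \<in> E) \<and>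
     (\<forall>u v. {u, v} \<in> E \<longrightarrow> ((u, v) \<in> A \<longleftrightarrow> (v, u) \<notin> A))"

definition out_nbhd :: "'a set \<Rightarrow> ('a \<times> 'a) set \<Rightarrow> 'a \<Rightarrow> 'a set" where
  "out_nbhd V A v = {w \<in> V - {v}. (v, w) \<in> A}"

definition second_out_nbhd :: "'a set \<Rightarrow> ('a \<times> 'a) set \<Rightarrow> 'a \<Rightarrow> 'a set" where
  "second_out_nbhd V A v =
     {w \<in> V - ({v} \<union> out_nbhd V A v). \<exists>u \<in> out_nbhd V A v. (u, w) \<in> A}"

definition seymour_vertex :: "'a set \<Rightarrow> ('a \<times> 'a) set \<Rightarrow> 'a \<Rightarrow> bool" where
  "seymour_vertex V A v \<longleftrightarrow>
     v \<in> V \<and> card (second_out_nbhd V A v) \<ge> card (out_nbhd V A v)"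

end

theory Submission
  imports Defs "HOL-Real_Asymp.Real_Asymp"
begin

text \<open>
  Asymptotically almost surely, any two disjoint linear-sized vertex sets span at least half the
  expected number of edges, and all degrees are at most \<open>(1/2 - \<gamma>) n\<close> for some \<open>\<gamma> > 0\<close>. If an
  orientation of such a graph has no Seymour vertex, then the first two outneighbourhoods of any
  vertex miss a set \<open>Z\<close> of at least \<open>2 \<gamma> n\<close> vertices. A suitable vertex of \<open>Z\<close> robustly reaches, within two
  steps, almost everything that the original vertex did, and in addition linearly many vertices
  of \<open>Z\<close>. Repeating this boundedly many times reaches more than \<open>n\<close> vertices.
\<close>

section \<open>Orientations of graphs that are dense between large disjoint sets\<close>

locale quasirandom_orientation =
  fixes V :: "'a set" and E :: "'a set set" and A :: "('a \<times> 'a) set" and q \<epsilon> :: real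
  assumes finite_V: "finite V"
    and orient: "orientation_of E A"
    and q_pos: "0 < q" and q_le: "q \<le> 1"
    and large: "1 \<le> \<epsilon> * card V"
    and dense: "\<lbrakk>S \<subseteq> V; T \<subseteq> V; S \<inter> T = {}; \<epsilon> * card V \<le> card S; \<epsilon> * card V \<le> card T\<rbrakk>
      \<Longrightarrow> q * card S * card T \<le> card {(s, t) \<in> S \<times> T. {s, t} \<in> E}"
begin

text \<open>Otherwise \<open>dense\<close> would apply to the low-degree vertices and
  \<open>S\<close>, while summing the degrees of those vertices into \<open>S\<close> gives fewer
  edges than \<open>dense\<close> provides.\<close>

lemma few_low_degree:
  assumes "S \<subseteq> V" "U \<subseteq> V" "S \<inter> U = {}" "\<epsilon> * card V \<le> card S"
  shows "card {u \<in> U. card {s \<in> S. {u, s} \<in> E} < q * card S} < \<epsilon> * card V"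
proof (rule ccontr)
  define B where "B = {u \<in> U. card {s \<in> S. {u, s} \<in> E} < q * card S}"
  assume "\<not> ?thesis"
  then have B: "\<epsilon> * card V \<le> card B" by (simp add: B_def)
  have fin: "finite B" "finite S"
    using assms finite_V by (auto simp: B_def intro: finite_subset)
  have ne: "B \<noteq> {}" using B large by auto
  have "q * card B * card S \<le> card {(u, s) \<in> B \<times> S. {u, s} \<in> E}"
    using B assms by (intro dense) (auto simp: B_def)
  also have "{(u, s) \<in> B \<times> S. {u, s} \<in> E} = (SIGMA u:B. {s \<in> S. {u, s} \<in> E})" by auto
  also have "real (card \<dots>) = (\<Sum>u\<in>B. real (card {s \<in> S. {u, s} \<in> E}))"
    using fin by (subst card_SigmaI) auto
  also have "\<dots> < (\<Sum>u\<in>B. q * card S)"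
    using fin ne by (intro sum_strict_mono) (auto simp: B_def)
  finally show False by (simp add: mult_ac)
qed

text \<open>Halving \<open>U\<close> yields at least \<open>q * card U * card U / 8\<close> edges
  inside \<open>U\<close>. Each is an out-edge of one of its ends, so this is a lower bound for the
  sum of the outdegrees within \<open>U\<close>, and some vertex attains the average.\<close>

lemma large_internal_outdegree:
  assumes "U \<subseteq> V" "4 * (\<epsilon> * card V) \<le> card U"
  obtains u where "u \<in> U" "q * card U / 8 \<le> card (out_nbhd V A u \<inter> U)"
proof (rule ccontr)
  assume no: "\<not> thesis"
  have fin: "finite U" using assms finite_V finite_subset by auto
  have four: "4 \<le> card U" using assms large by linarith
  obtain S where S: "S \<subseteq> U" "card S = card U div 2"
    using obtain_subset_with_card_n[of "card U div 2" U] by auto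
  define T where "T = U - S"
  have T: "card T = card U - card U div 2"
    using S fin by (simp add: T_def card_Diff_subset finite_subset)
  \<comment> \<open>The quarter absorbs the rounding in \<open>card U div 2\<close>, and still
    leaves \<open>S\<close> with at least \<epsilon> * \<open>card V\<close> elements.\<close>
  have S4: "real (card U) / 4 \<le> card S" and T2: "real (card U) / 2 \<le> card T"
    using S T four by linarith+
  have "q * card U * card U / 8 = q * (real (card U) / 4 * (real (card U) / 2))" by simp
  also have "\<dots> \<le> q * (real (card S) * real (card T))"
    using S4 T2 q_pos by (intro mult_left_mono mult_mono) auto
  also have "\<dots> = q * card S * card T" by simp
  also have "\<dots> \<le> card {(s, t) \<in> S \<times> T. {s, t} \<in> E}"
    using S S4 T2 assms by (intro dense) (auto simp: T_def)
  also have "\<dots> \<le> card (SIGMA u:U. out_nbhd V A u \<inter> U)"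
  proof -
    \<comment> \<open>Each edge is sent to its direction in \<open>A\<close>; this is injective
      because \<open>S\<close> and \<open>T\<close> are disjoint.\<close>
    let ?f = "\<lambda>(s, t). if (s, t) \<in> A then (s, t) else (t, s)"
    have "inj_on ?f {(s, t) \<in> S \<times> T. {s, t} \<in> E}"
      by (auto simp: inj_on_def T_def split: if_splits)
    moreover have "?f x \<in> (SIGMA u:U. out_nbhd V A u \<inter> U)"
      if "x \<in> {(s, t) \<in> S \<times> T. {s, t} \<in> E}" for x
    proof -
      obtain s t where x: "x = (s, t)" "s \<in> S" "t \<in> T" "{s, t} \<in> E"
        using \<open>x \<in> _\<close> by auto
      then have "s \<in> U" "t \<in> U" "s \<in> V" "t \<in> V" "s \<noteq> t"
        using S assms by (auto simp: T_def)
      moreover have "(s, t) \<in> A \<or> (t, s) \<in> A"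
        using orient x by (auto simp: orientation_of_def)
      ultimately show ?thesis by (auto simp: x out_nbhd_def)
    qed
    moreover have "finite (SIGMA u:U. out_nbhd V A u \<inter> U)"
      using fin by auto
    ultimately show ?thesis
      by (intro of_nat_mono card_inj_on_le[of ?f] image_subsetI) assumption+
  qed
  also have "\<dots> = (\<Sum>u\<in>U. real (card (out_nbhd V A u \<inter> U)))"
    using fin by (subst card_SigmaI) auto
  also have "\<dots> < (\<Sum>u\<in>U. q * card U / 8)"
    using fin four no that by (intro sum_strict_mono) (auto simp: not_le[symmetric])
  finally show False by (simp add: mult_ac)
qed

text \<open>Being reached through linearly many intermediate vertices passes on to a typical vertex
  of the unreached set, with the threshold shrunk by the factor \<open>q\<close>. Being reached
  through a single one would not.\<close>

definition reach :: "real \<Rightarrow> 'a \<Rightarrow> 'a set" where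
  "reach \<delta> v = out_nbhd V A v \<union> {w \<in> V. \<delta> * card V \<le> card {x \<in> out_nbhd V A v. (x, w) \<in> A}}"

lemma reach_subset: "reach \<delta> v \<subseteq> V"
  by (auto simp: reach_def out_nbhd_def)

text \<open>Let \<open>X\<close> be the outneighbourhood of \<open>v\<close> and \<open>Z\<close> the set of vertices not reached from \<open>v\<close> in
  at most two steps, so that every edge between \<open>X\<close> and \<open>Z\<close> points into \<open>X\<close>. A typical \<open>z \<in> Z\<close> then
  sends edges to a proportion \<open>q\<close> of the in-neighbours in \<open>X\<close> of almost every vertex robustly reached
  from \<open>v\<close>. If \<open>z\<close> also has linearly many outneighbours in \<open>Z\<close>, these reach almost all of \<open>X\<close> and are
  themselves new.\<close>

lemma reach_grows:
  fixes \<gamma> c \<delta> \<delta>' :: real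
  assumes v: "v \<in> V" "\<not> seymour_vertex V A v"
    and deg: "card (out_nbhd V A v) \<le> (1 / 2 - \<gamma>) * card V"
    and \<gamma>: "0 < \<gamma>" "\<gamma> \<le> 1"
    and c: "c = q * \<gamma> / 8"
    and \<epsilon>: "\<epsilon> \<le> c * \<gamma> / 4"
    and \<delta>: "\<epsilon> \<le> \<delta>" "\<delta>' \<le> q * \<delta>" "\<delta>' \<le> q * c"
  obtains z where "z \<in> V" "card (reach \<delta> v) + c / 2 * card V \<le> card (reach \<delta>' z)"
proof -
  define n where "n = real (card V)"
  define X where "X = out_nbhd V A v"
  define Z where "Z = V - ({v} \<union> X \<union> second_out_nbhd V A v)"
  define S where "S y = {x \<in> X. (x, y) \<in> A}" for y
  define Y where "Y = {w \<in> V. \<delta> * n \<le> card (S w)}"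
  \<comment> \<open>A vertex of \<open>Z\<close> outside \<open>bad y\<close> sends edges to a
    proportion \<open>q\<close> of \<open>S y\<close>; for a vertex of \<open>Z\<close> outside
    \<open>Zb\<close> this fails for less than \<open>c / 4 * n\<close> of the \<open>y\<close> in
    \<open>Y\<close>.\<close>
  define bad where "bad y = {z \<in> Z. card {s \<in> S y. {z, s} \<in> E} < q * card (S y)}" for y
  define Zb where "Zb = {z \<in> Z. c / 4 * n \<le> card {y \<in> Y. z \<in> bad y}}"
  define U where "U = Z - Zb"
  have n: "1 \<le> \<epsilon> * n" using large by (simp add: n_def)
  have n0: "0 < n"
    using n by (cases "n = 0") (auto simp: n_def)
  have \<epsilon>0: "0 < \<epsilon>" using n n0 by (smt (verit) mult_nonpos_nonneg)
  have c0: "0 < c" unfolding c using q_pos \<gamma> by simp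
  have c8: "c \<le> \<gamma> / 8" unfolding c using q_pos q_le \<gamma> by (simp add: mult_left_le_one_le)
  have sub: "X \<subseteq> V" "Y \<subseteq> V" "Z \<subseteq> V" "\<And>y. S y \<subseteq> X" "U \<subseteq> Z"
    by (auto simp: X_def out_nbhd_def Y_def Z_def S_def U_def)
  have fin: "finite X" "finite Y" "finite Z" "\<And>y. finite (S y)" "finite U"
    using sub finite_V by (meson finite_subset)+
  have XZ: "X \<inter> Z = {}" by (auto simp: Z_def)
  have into_X: "(z, x) \<in> A" if "z \<in> Z" "x \<in> X" "{z, x} \<in> E" for z x
  proof -
    have "(x, z) \<notin> A"
      using that by (auto simp: Z_def X_def second_out_nbhd_def)
    then show ?thesis
      using that orient by (auto simp: orientation_of_def)
  qed
  have cardZ: "2 * \<gamma> * n \<le> card Z"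
  proof -
    have fin2: "finite (second_out_nbhd V A v)"
      using finite_V by (auto simp: second_out_nbhd_def)
    have "card ({v} \<union> X \<union> second_out_nbhd V A v) \<le> 1 + card X + card (second_out_nbhd V A v)"
      using card_Un_le[of "{v} \<union> X" "second_out_nbhd V A v"] card_Un_le[of "{v}" X] by simp
    \<comment> \<open>As \<open>v\<close> is not a Seymour vertex, its second outneighbourhood is
      strictly smaller than \<open>X\<close>, which makes up for the 1 that counts \<open>v\<close>
      itself.\<close>
    also have "\<dots> \<le> 2 * card X"
      using v by (auto simp: seymour_vertex_def X_def)
    also have "real (2 * card X) \<le> n - 2 * \<gamma> * n"
      using deg by (simp add: X_def n_def algebra_simps)
    finally have "real (card ({v} \<union> X \<union> second_out_nbhd V A v)) \<le> n - 2 * \<gamma> * n" by simp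
    moreover have "card V - card ({v} \<union> X \<union> second_out_nbhd V A v) \<le> card Z"
      unfolding Z_def by (rule diff_card_le_card_Diff) (use fin fin2 in auto)
    ultimately show ?thesis by (simp add: n_def)
  qed
  have card_bad: "card (bad y) \<le> \<epsilon> * n" if "y \<in> Y" for y
  proof -
    have "\<epsilon> * n \<le> \<delta> * n" using \<delta> n0 by simp
    also have "\<dots> \<le> card (S y)" using that by (simp add: Y_def)
    finally have "card (bad y) < \<epsilon> * card V"
      unfolding bad_def using sub(1,3) sub(4)[of y] XZ n_def by (intro few_low_degree) auto
    then show ?thesis by (simp add: n_def)
  qed
  \<comment> \<open>Double counting of the pairs with \<open>z \<in> bad y\<close>: each
    \<open>z\<close> in \<open>Zb\<close> lies in at least \<open>c / 4 * n\<close> of them, each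
    \<open>y\<close> in at most \<epsilon> * n. The bound on \<epsilon> then gives
    \<open>card Zb\<close> at most \<gamma> * n, half of what \<open>Z\<close> is known to
    have.\<close>
  have "c / 4 * n * card Zb = (\<Sum>z\<in>Zb. c / 4 * n)" by simp
  also have "\<dots> \<le> (\<Sum>z\<in>Zb. real (card {y \<in> Y. z \<in> bad y}))"
    by (intro sum_mono) (auto simp: Zb_def)
  also have "\<dots> \<le> (\<Sum>z\<in>Z. real (card {y \<in> Y. z \<in> bad y}))"
    using fin by (intro sum_mono2) (auto simp: Zb_def)
  also have "\<dots> = (\<Sum>z\<in>Z. \<Sum>y\<in>Y. if z \<in> bad y then 1 else 0)"
    using fin by (simp add: sum.If_cases Int_def)
  also have "\<dots> = (\<Sum>y\<in>Y. \<Sum>z\<in>Z. if z \<in> bad y then 1 else 0)"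
    by (rule sum.swap)
  also have "\<dots> = (\<Sum>y\<in>Y. real (card (bad y)))"
    using fin by (intro sum.cong refl)
      (auto simp: sum.If_cases bad_def Int_def conj_commute intro!: arg_cong[of _ _ card])
  also have "\<dots> \<le> (\<Sum>y\<in>Y. \<epsilon> * n)"
    using card_bad by (intro sum_mono)
  also have "\<dots> \<le> n * (\<epsilon> * n)"
    using card_mono[OF finite_V sub(2)] \<epsilon>0 n0 by (simp add: n_def mult_right_mono)
  also have "\<dots> \<le> n * (c * \<gamma> / 4 * n)"
    using \<epsilon> n0 by (intro mult_left_mono mult_right_mono) auto
  also have "\<dots> = c / 4 * n * (\<gamma> * n)" by simp
  finally have "card Zb \<le> \<gamma> * n"
    using c0 n0 by simp
  moreover have "card Z - card Zb \<le> card U"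
    unfolding U_def by (rule diff_card_le_card_Diff) (use fin in \<open>auto simp: Zb_def\<close>)
  ultimately have cardU: "\<gamma> * n \<le> card U"
    using cardZ by linarith
  have "4 * \<epsilon> \<le> \<gamma>"
  proof -
    have "c * \<gamma> \<le> c" using c0 \<gamma> by (simp add: mult_left_le)
    then show ?thesis using \<epsilon> c8 \<gamma> by linarith
  qed
  then have "4 * \<epsilon> * n \<le> \<gamma> * n" using n0 by simp
  then have "4 * (\<epsilon> * card V) \<le> card U" using cardU by (simp add: n_def)
  then obtain z where z: "z \<in> U" "q * card U / 8 \<le> card (out_nbhd V A z \<inter> U)"
    using large_internal_outdegree[of U] sub(3,5) by blast
  define W where "W = out_nbhd V A z \<inter> Z"
  have W: "c * n \<le> card W" "W \<subseteq> Z" "finite W"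
  proof -
    \<comment> \<open>The value of \<open>c\<close> combines the outdegree
      \<open>q * card U / 8\<close> of \<open>z\<close> within \<open>U\<close> with the lower bound
      \<gamma> * n on \<open>card U\<close>.\<close>
    have "c * n = q * (\<gamma> * n) / 8" by (simp add: c)
    also have "\<dots> \<le> q * card U / 8" using cardU q_pos by (simp add: mult_left_mono)
    also note z(2)
    also have "real (card (out_nbhd V A z \<inter> U)) \<le> card W"
      using fin sub by (intro of_nat_mono card_mono) (auto simp: W_def)
    finally show "c * n \<le> card W" .
  qed (use fin in \<open>auto simp: W_def\<close>)
  \<comment> \<open>\<open>Xb\<close> and \<open>Yb\<close> contain whatever of
    \<open>reach \<delta> v\<close> may be lost in passing to \<open>z\<close>. Each costs at most
    \<open>c / 4 * n\<close>, while \<open>W\<close> contributes at least \<open>c * n\<close> new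
    vertices, for a net gain of \<open>c / 2 * n\<close>.\<close>
  define Xb where "Xb = {x \<in> X. card {w \<in> W. {x, w} \<in> E} < q * card W}"
  define Yb where "Yb = {y \<in> Y. z \<in> bad y}"
  have \<epsilon>4: "\<epsilon> \<le> c / 4"
  proof -
    have "c * \<gamma> \<le> c" using c0 \<gamma> by (simp add: mult_left_le)
    then show ?thesis using \<epsilon> by linarith
  qed
  have \<epsilon>n: "\<epsilon> * n \<le> c / 4 * n" using \<epsilon>4 n0 by (intro mult_right_mono) auto
  have Xb: "card Xb \<le> c / 4 * n"
  proof -
    have "\<epsilon> * n \<le> card W" using \<epsilon>n W(1) mult_pos_pos[OF c0 n0] by linarith
    then have "card Xb < \<epsilon> * card V"
      unfolding Xb_def using W sub XZ by (intro few_low_degree) (auto simp: n_def)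
    then show ?thesis using \<epsilon>n by (simp add: n_def)
  qed
  have Yb: "card Yb \<le> c / 4 * n"
    using z sub by (auto simp: U_def Zb_def Yb_def)
  have out_fin: "finite (out_nbhd V A z)"
    using finite_V by (auto simp: out_nbhd_def)
  \<comment> \<open>Edges between \<open>W\<close> and \<open>X\<close> point into \<open>X\<close>,
    so \<open>x\<close> is reached from \<open>z\<close> through at least \<open>q * card W\<close>
    vertices of \<open>W\<close>.\<close>
  have inX: "x \<in> reach \<delta>' z" if "x \<in> X - Xb" for x
  proof -
    have "\<delta>' * n \<le> q * c * n" using \<delta> n0 by simp
    also have "\<dots> = q * (c * n)" by simp
    also have "\<dots> \<le> q * card W" using W q_pos by (intro mult_left_mono) auto
    also have "\<dots> \<le> card {w \<in> W. {x, w} \<in> E}" using that by (auto simp: Xb_def)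
    also have "\<dots> \<le> card {w \<in> out_nbhd V A z. (w, x) \<in> A}"
      using that out_fin into_X by (intro of_nat_mono card_mono) (auto simp: W_def insert_commute)
    finally show ?thesis using that sub by (auto simp: reach_def n_def)
  qed
  \<comment> \<open>The intermediate vertices are now those of \<open>S y\<close>, which already
    lead to \<open>y\<close>; \<open>z\<close> sends edges to a proportion \<open>q\<close> of
    them.\<close>
  have inY: "y \<in> reach \<delta>' z" if "y \<in> Y - Yb" for y
  proof -
    have "\<delta>' * n \<le> q * \<delta> * n" using \<delta> n0 by simp
    also have "\<dots> = q * (\<delta> * n)" by simp
    also have "\<dots> \<le> q * card (S y)" using that q_pos by (intro mult_left_mono) (auto simp: Y_def)
    also have "\<dots> \<le> card {s \<in> S y. {z, s} \<in> E}"
      using that z sub by (auto simp: Yb_def bad_def)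
    also have "\<dots> \<le> card {w \<in> out_nbhd V A z. (w, y) \<in> A}"
    proof (intro of_nat_mono card_mono)
      show "{s \<in> S y. {z, s} \<in> E} \<subseteq> {w \<in> out_nbhd V A z. (w, y) \<in> A}"
        using z sub(1,5) XZ into_X by (auto simp: S_def out_nbhd_def)
    qed (use out_fin in auto)
    finally show ?thesis using that sub by (auto simp: reach_def n_def)
  qed
  have reach_v: "reach \<delta> v = X \<union> Y"
    by (auto simp: reach_def X_def Y_def S_def n_def)
  \<comment> \<open>The threshold is positive, so every vertex of \<open>Y\<close> has an
    in-neighbour in \<open>X\<close> and thus lies outside \<open>Z\<close>.\<close>
  have disj: "(X \<union> Y) \<inter> W = {}"
  proof -
    have "y \<notin> Z" if "y \<in> Y" for y
    proof -
      have "0 < \<delta> * n" using \<delta> \<epsilon>0 n0 by simp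
      then have "S y \<noteq> {}" using that by (auto simp: Y_def)
      then show ?thesis using that by (auto simp: Z_def S_def X_def second_out_nbhd_def)
    qed
    then show ?thesis using XZ W by blast
  qed
  have "card (X \<union> Y) - card (Xb \<union> Yb) \<le> card ((X \<union> Y) - (Xb \<union> Yb))"
    by (rule diff_card_le_card_Diff) (use fin in \<open>auto simp: Xb_def Yb_def\<close>)
  moreover have "card (Xb \<union> Yb) \<le> card Xb + card Yb" by (rule card_Un_le)
  ultimately have "real (card (X \<union> Y)) + c / 2 * n \<le> card ((X \<union> Y) - (Xb \<union> Yb)) + real (card W)"
    using Xb Yb W by linarith
  also have "\<dots> = card (((X \<union> Y) - (Xb \<union> Yb)) \<union> W)"
    using disj fin W by (subst card_Un_disjoint) auto
  also have "\<dots> \<le> card (reach \<delta>' z)"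
  proof (intro of_nat_mono card_mono)
    show "finite (reach \<delta>' z)" using reach_subset finite_V finite_subset by blast
    show "((X \<union> Y) - (Xb \<union> Yb)) \<union> W \<subseteq> reach \<delta>' z"
      using inX inY by (auto simp: W_def reach_def)
  qed
  finally show thesis
    using that[of z] z sub reach_v by (auto simp: n_def)
qed

text \<open>\<open>K\<close> applications of \<open>reach_grows\<close> would reach more than
  \<open>card V\<close> vertices. The threshold falls from \<open>c\<close> to
  \<open>c * q ^ K\<close> on the way, and \<epsilon> is small enough to stay below it
  throughout.\<close>

lemma seymour_vertex_exists:
  fixes \<gamma> c :: real
  assumes deg: "\<And>v. v \<in> V \<Longrightarrow> card (out_nbhd V A v) \<le> (1 / 2 - \<gamma>) * card V"
    and \<gamma>: "0 < \<gamma>" "\<gamma> \<le> 1"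
    and c: "c = q * \<gamma> / 8"
    and \<epsilon>: "\<epsilon> \<le> c * \<gamma> / 4" "\<epsilon> \<le> c * q ^ K"
    and K: "2 < K * c"
  shows "\<exists>v. seymour_vertex V A v"
proof (rule ccontr)
  assume no: "\<nexists>v. seymour_vertex V A v"
  have c0: "0 < c" unfolding c using q_pos \<gamma> by simp
  have V0: "0 < card V" using large by (cases "card V = 0") auto
  have "\<exists>v\<in>V. k * (c / 2) * card V \<le> card (reach (c * q ^ k) v)" if "k \<le> K" for k
    using that
  proof (induction k)
    case 0
    then show ?case using V0 by (auto simp: card_gt_0_iff)
  next
    case (Suc k)
    then obtain v where v: "v \<in> V" "k * (c / 2) * card V \<le> card (reach (c * q ^ k) v)" by auto
    have "c * q ^ K \<le> c * q ^ k"
      using Suc c0 q_pos q_le by (intro mult_left_mono power_decreasing) auto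
    then have 1: "\<epsilon> \<le> c * q ^ k" using \<epsilon> by linarith
    have "q ^ k \<le> 1" using q_pos q_le by (intro power_le_one) auto
    then have 2: "c * q ^ Suc k \<le> q * c"
      using c0 q_pos by (simp add: mult_left_le)
    obtain z where "z \<in> V" "card (reach (c * q ^ k) v) + c / 2 * card V \<le> card (reach (c * q ^ Suc k) z)"
      using no by (rule_tac reach_grows[OF v(1) _ deg[OF v(1)] \<gamma> c \<epsilon>(1) 1 _ 2]) auto
    then show ?case using v(2) by (intro bexI[of _ z]) (auto simp: algebra_simps)
  qed
  then obtain v where "K * (c / 2) * card V \<le> card (reach (c * q ^ K) v)" by blast
  also have "\<dots> \<le> card V"
    using reach_subset finite_V by (intro of_nat_mono card_mono)
  finally have "K * (c / 2) \<le> 1" using V0 by simp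
  then show False using K by simp
qed

end

section \<open>Edge counts in the binomial random graph\<close>

lemma finite_complete_edges: "finite V \<Longrightarrow> finite (complete_edges V)"
  by (rule finite_subset[of _ "Pow V"]) (auto simp: complete_edges_def)

text \<open>The marginal of the product distribution on \<open>F\<close> is again a product of
  Bernoulli distributions, and its number of successes is binomial.\<close>

lemma map_card_Int_gnp:
  assumes "F \<subseteq> complete_edges {..<n}" "p \<in> {0..1}"
  shows "map_pmf (\<lambda>E. card (E \<inter> F)) (gnp n p) = binomial_pmf (card F) p"
proof -
  let ?C = "complete_edges {..<n}"
  have fin: "finite ?C" "finite F"
    using finite_complete_edges assms by (auto intro: finite_subset)
  have "binomial_pmf (card F) p =
      map_pmf (\<lambda>f. card {x \<in> F. f x}) (Pi_pmf F False (\<lambda>_. bernoulli_pmf p))"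
    using fin assms by (intro binomial_pmf_altdef') auto
  also have "Pi_pmf F False (\<lambda>_. bernoulli_pmf p) =
      map_pmf (\<lambda>f x. if x \<in> F then f x else False) (Pi_pmf ?C False (\<lambda>_. bernoulli_pmf p))"
    using fin assms by (intro Pi_pmf_subset) auto
  finally have "binomial_pmf (card F) p =
      map_pmf (\<lambda>f. card {x \<in> F. f x}) (Pi_pmf ?C False (\<lambda>_. bernoulli_pmf p))"
    by (simp add: pmf.map_comp o_def cong: conj_cong)
  moreover have "{e \<in> ?C. f e} \<inter> F = {x \<in> F. f x}" for f
    using assms by auto
  ultimately show ?thesis
    by (simp add: gnp_def pmf.map_comp o_def)
qed

lemma prob_gnp_card_Int:
  assumes "F \<subseteq> complete_edges {..<n}" "p \<in> {0..1}"
  shows "measure_pmf.prob (gnp n p) {E. P (card (E \<inter> F))} =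
    measure_pmf.prob (binomial_pmf (card F) p) {k. P k}"
  unfolding map_card_Int_gnp[OF assms, symmetric] by (simp add: vimage_def)

text \<open>Hoeffding's lower tail for a deviation of half the mean. Both sets being linear in size
  makes the exponent quadratic in \<open>n\<close>, enough to beat the number of pairs of
  sets.\<close>

lemma prob_low_density:
  fixes p \<epsilon> :: real
  assumes p: "0 < p" "p \<le> 1" and \<epsilon>: "0 < \<epsilon>" and n: "0 < n"
    and ST: "S \<subseteq> {..<n}" "T \<subseteq> {..<n}" "S \<inter> T = {}" "\<epsilon> * n \<le> card S" "\<epsilon> * n \<le> card T"
  shows "measure_pmf.prob (gnp n p)
      {E. card {(s, t) \<in> S \<times> T. {s, t} \<in> E} < p / 2 * card S * card T}
    \<le> exp (- (p\<^sup>2 * \<epsilon>\<^sup>2 / 2) * n\<^sup>2)"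
proof -
  define f :: "nat \<times> nat \<Rightarrow> nat set" where "f = (\<lambda>(s, t). {s, t})"
  define F where "F = f ` (S \<times> T)"
  have inj: "inj_on f (S \<times> T)"
    using ST(3) by (auto simp: inj_on_def f_def doubleton_eq_iff)
  have F: "F \<subseteq> complete_edges {..<n}"
    using ST by (auto simp: F_def f_def complete_edges_def card_insert_if)
  have "real (card {(s, t) \<in> S \<times> T. {s, t} \<in> E}) = card (E \<inter> F)" for E
  proof -
    have "E \<inter> F = f ` {(s, t) \<in> S \<times> T. {s, t} \<in> E}" by (auto simp: F_def f_def)
    then show ?thesis
      by (simp add: card_image inj_on_subset[OF inj] Collect_case_prod_Sigma subset_iff)
  qed
  note card_eq = this
  have cardF: "card F = card S * card T"
    by (simp add: F_def card_image[OF inj] card_cartesian_product)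
  have "\<epsilon>\<^sup>2 * n\<^sup>2 = (\<epsilon> * n) * (\<epsilon> * n)" by (simp add: power2_eq_square)
  also have "\<dots> \<le> real (card S) * real (card T)"
    using ST \<epsilon> by (intro mult_mono) auto
  finally have m: "\<epsilon>\<^sup>2 * n\<^sup>2 \<le> card F" by (simp add: cardF)
  moreover have "0 < \<epsilon>\<^sup>2 * n\<^sup>2" using \<epsilon> n by simp
  ultimately have m0: "0 < card F" by (cases "card F = 0") auto
  interpret binomial_distribution "card F" p
    using p by unfold_locales auto
  have "measure_pmf.prob (gnp n p)
      {E. card {(s, t) \<in> S \<times> T. {s, t} \<in> E} < p / 2 * card S * card T}
    = measure_pmf.prob (binomial_pmf (card F) p) {k. k < p / 2 * card F}"
    using p F unfolding card_eq by (subst prob_gnp_card_Int) (auto simp: cardF mult.assoc)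
  also have "\<dots> \<le> measure_pmf.prob (binomial_pmf (card F) p) {k. k \<le> card F * p - p / 2 * card F}"
    by (intro measure_pmf.finite_measure_mono) (auto simp: algebra_simps)
  also have "\<dots> \<le> exp (- 2 * (p / 2 * card F)\<^sup>2 / card F)"
    using m0 p by (intro prob_le) auto
  also have "- 2 * (p / 2 * card F)\<^sup>2 / card F = - (p\<^sup>2 / 2 * card F)"
    using m0 by (simp add: power2_eq_square field_simps)
  also have "exp \<dots> \<le> exp (- (p\<^sup>2 / 2 * (\<epsilon>\<^sup>2 * n\<^sup>2)))"
    using m by (simp add: mult_left_mono)
  finally show ?thesis by (simp add: mult_ac)
qed

lemma prob_high_degree:
  fixes p \<gamma> :: real
  assumes p: "0 \<le> p" "p \<le> 1" and \<gamma>: "0 < \<gamma>" and v: "v < n" and n: "2 \<le> n"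
  shows "measure_pmf.prob (gnp n p) {E. (p + \<gamma>) * n < card {w \<in> {..<n}. w \<noteq> v \<and> {v, w} \<in> E}}
    \<le> exp (- 2 * \<gamma>\<^sup>2 * n)"
proof -
  define f where "f w = {v, w}" for w
  define F where "F = f ` ({..<n} - {v})"
  have inj: "inj_on f B" for B
    by (auto simp: inj_on_def f_def doubleton_eq_iff)
  have F: "F \<subseteq> complete_edges {..<n}"
    using v by (auto simp: F_def f_def complete_edges_def card_2_iff)
  have card_eq: "card {w \<in> {..<n}. w \<noteq> v \<and> {v, w} \<in> E} = card (E \<inter> F)" for E
  proof -
    have "E \<inter> F = f ` {w \<in> {..<n}. w \<noteq> v \<and> {v, w} \<in> E}" by (auto simp: F_def f_def)
    then show ?thesis by (simp add: card_image inj)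
  qed
  have cardF: "card F = n - 1"
    using v by (simp add: F_def card_image inj)
  interpret binomial_distribution "card F" p
    using p by unfold_locales auto
  have "measure_pmf.prob (gnp n p) {E. (p + \<gamma>) * n < card {w \<in> {..<n}. w \<noteq> v \<and> {v, w} \<in> E}}
    = measure_pmf.prob (binomial_pmf (card F) p) {k. (p + \<gamma>) * n < k}"
    using p F unfolding card_eq by (subst prob_gnp_card_Int) auto
  \<comment> \<open>The degree has mean \<open>(n - 1) * p\<close>, so the threshold exceeds it by
    at least \<gamma> * n, as Hoeffding's upper tail requires.\<close>
  also have "\<dots> \<le> measure_pmf.prob (binomial_pmf (card F) p) {k. card F * p + \<gamma> * n \<le> k}"
  proof (intro measure_pmf.finite_measure_mono, safe)
    fix k :: nat assume "(p + \<gamma>) * n < k"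
    moreover have "card F * p \<le> n * p" using p by (intro mult_right_mono) (auto simp: cardF)
    ultimately show "card F * p + \<gamma> * n \<le> k" by (simp add: algebra_simps)
  qed auto
  also have "\<dots> \<le> exp (- 2 * (\<gamma> * n)\<^sup>2 / card F)"
    using n \<gamma> by (intro prob_ge) (auto simp: cardF)
  also have "\<dots> \<le> exp (- 2 * \<gamma>\<^sup>2 * n)"
  proof -
    have "real (card F) * (\<gamma>\<^sup>2 * n) \<le> n * (\<gamma>\<^sup>2 * n)"
      by (intro mult_right_mono) (auto simp: cardF)
    then have "\<gamma>\<^sup>2 * n \<le> (\<gamma> * n)\<^sup>2 / card F"
      using n by (simp add: le_divide_eq cardF power2_eq_square mult_ac)
    then show ?thesis by simp
  qed
  finally show ?thesis .
qed

lemma out_nbhd_subset_nbhd: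
  "orientation_of E A \<Longrightarrow> out_nbhd V A v \<subseteq> {w \<in> V. w \<noteq> v \<and> {v, w} \<in> E}"
  by (auto simp: out_nbhd_def orientation_of_def)

section \<open>Union bounds for the exceptional graphs\<close>

definition sparse_pair_graphs :: "nat \<Rightarrow> real \<Rightarrow> real \<Rightarrow> nat set set set" where
  "sparse_pair_graphs n q \<epsilon> = {E. \<exists>S T. S \<subseteq> {..<n} \<and> T \<subseteq> {..<n} \<and> S \<inter> T = {} \<and>
     \<epsilon> * real n \<le> real (card S) \<and> \<epsilon> * real n \<le> real (card T) \<and>
     real (card {(s, t) \<in> S \<times> T. {s, t} \<in> E}) < q * real (card S) * real (card T)}"

definition high_degree_graphs :: "nat \<Rightarrow> real \<Rightarrow> nat set set set" where
  "high_degree_graphs n d =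
     {E. \<exists>v<n. d * real n < card {w \<in> {..<n}. w \<noteq> v \<and> {v, w} \<in> E}}"

lemma prob_sparse_pair_graphs:
  fixes p \<epsilon> :: real
  assumes p: "0 < p" "p \<le> 1" and \<epsilon>: "0 < \<epsilon>" and n: "0 < n"
  shows "measure_pmf.prob (gnp n p) (sparse_pair_graphs n (p / 2) \<epsilon>)
    \<le> 4 ^ n * exp (- (p\<^sup>2 * \<epsilon>\<^sup>2 / 2) * n\<^sup>2)"
proof -
  define I where "I = {(S, T). S \<subseteq> {..<n} \<and> T \<subseteq> {..<n} \<and> S \<inter> T = {} \<and>
     \<epsilon> * real n \<le> real (card S) \<and> \<epsilon> * real n \<le> real (card T)}"
  define L where "L = (\<lambda>(S :: nat set, T).
     {E. real (card {(s, t) \<in> S \<times> T. {s, t} \<in> E}) < p / 2 * real (card S) * real (card T)})"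
  have I: "I \<subseteq> Pow {..<n} \<times> Pow {..<n}" by (auto simp: I_def)
  then have fin: "finite I" by (rule finite_subset) auto
  have "card I \<le> card (Pow {..<n} \<times> Pow {..<n})" using I by (intro card_mono) auto
  also have "\<dots> = 4 ^ n" by (simp add: card_cartesian_product card_Pow power_mult_distrib[symmetric])
  finally have cardI: "real (card I) \<le> 4 ^ n" by (simp flip: of_nat_le_iff)
  have "sparse_pair_graphs n (p / 2) \<epsilon> = (\<Union>i\<in>I. L i)"
    by (auto simp: sparse_pair_graphs_def I_def L_def)
  also have "measure_pmf.prob (gnp n p) \<dots> \<le> (\<Sum>i\<in>I. measure_pmf.prob (gnp n p) (L i))"
    using fin by (intro measure_pmf.finite_measure_subadditive_finite) auto
  also have "\<dots> \<le> (\<Sum>i\<in>I. exp (- (p\<^sup>2 * \<epsilon>\<^sup>2 / 2) * n\<^sup>2))"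
    using assms by (intro sum_mono) (auto simp: I_def L_def intro!: prob_low_density[simplified])
  also have "\<dots> \<le> 4 ^ n * exp (- (p\<^sup>2 * \<epsilon>\<^sup>2 / 2) * n\<^sup>2)"
    using cardI by (simp add: mult_right_mono)
  finally show ?thesis .
qed

lemma prob_high_degree_graphs:
  fixes p \<gamma> :: real
  assumes "0 \<le> p" "p \<le> 1" "0 < \<gamma>" "2 \<le> n"
  shows "measure_pmf.prob (gnp n p) (high_degree_graphs n (p + \<gamma>)) \<le> n * exp (- 2 * \<gamma>\<^sup>2 * n)"
proof -
  define L where "L v = {E. (p + \<gamma>) * n < card {w \<in> {..<n}. w \<noteq> v \<and> {v, w} \<in> E}}" for v
  have "high_degree_graphs n (p + \<gamma>) = (\<Union>v<n. L v)"
    by (auto simp: high_degree_graphs_def L_def)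
  also have "measure_pmf.prob (gnp n p) \<dots> \<le> (\<Sum>v<n. measure_pmf.prob (gnp n p) (L v))"
    by (intro measure_pmf.finite_measure_subadditive_finite) auto
  also have "\<dots> \<le> (\<Sum>v<n. exp (- 2 * \<gamma>\<^sup>2 * n))"
    using assms unfolding L_def by (intro sum_mono prob_high_degree) auto
  finally show ?thesis by simp
qed

section \<open>Choice of the constants and passage to the limit\<close>

theorem theorem1p2:
  fixes p :: real
  assumes "0 \<le> p" and "p < 1 / 2"
  shows "(\<lambda>n. measure_pmf.prob (gnp n p)
           {E. \<forall>A. orientation_of E A \<longrightarrow> (\<exists>v. seymour_vertex {..<n} A v)})
         \<longlonglongrightarrow> 1"
proof (cases "p = 0")
  \<comment> \<open>Without edges all outneighbourhoods are empty and every vertex is a Seymour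
    vertex; only \<open>n = 0\<close> fails. The density argument needs \<open>q\<close>
    positive.\<close>
  case True
  have "bernoulli_pmf 0 = return_pmf False"
  proof (rule pmf_eqI)
    show "pmf (bernoulli_pmf 0) x = pmf (return_pmf False) x" for x
      by (cases x) auto
  qed
  then have gnp0: "gnp n p = return_pmf {}" for n
    by (simp add: gnp_def True finite_complete_edges)
  have "\<exists>v. seymour_vertex {..<n} A v" if "orientation_of {} A" "0 < n" for n and A :: "(nat \<times> nat) set"
    using that by (intro exI[of _ 0]) (simp add: seymour_vertex_def out_nbhd_def orientation_of_def)
  then have "eventually (\<lambda>n. measure_pmf.prob (gnp n p)
      {E. \<forall>A. orientation_of E A \<longrightarrow> (\<exists>v. seymour_vertex {..<n} A v)} = 1) sequentially"
    by (intro eventually_mono[OF eventually_gt_at_top[of 0]]) (simp add: gnp0)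
  then show ?thesis by (rule tendsto_eventually)
next
  case False
  then have p: "0 < p" "p < 1 / 2" using assms by auto
  \<comment> \<open>Half the gap between \<open>p\<close> and 1/2: the degree threshold
    \<open>p + \<gamma>\<close> stays above the expected density and equals
    \<open>1 / 2 - \<gamma>\<close>.\<close>
  define \<gamma> where "\<gamma> = (1 / 2 - p) / 2"
  define q where "q = p / 2"
  define c where "c = q * \<gamma> / 8"
  have pos: "0 < \<gamma>" "\<gamma> \<le> 1" "0 < q" "q \<le> 1" "p + \<gamma> = 1 / 2 - \<gamma>"
    using p by (auto simp: \<gamma>_def q_def field_simps)
  then have c0: "0 < c" by (simp add: c_def)
  obtain K :: nat where K: "2 < K * c"
    using c0 ex_less_of_nat_mult by blast
  define \<epsilon> where "\<epsilon> = min (c * \<gamma> / 4) (c * q ^ K)"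
  have \<epsilon>: "0 < \<epsilon>" "\<epsilon> \<le> c * \<gamma> / 4" "\<epsilon> \<le> c * q ^ K"
    using c0 pos by (auto simp: \<epsilon>_def)
  define a where "a = p\<^sup>2 * \<epsilon>\<^sup>2 / 2"
  \<comment> \<open>The failure probability: \<open>n\<close> vertices for the degrees and at most
    \<open>4 ^ n\<close> pairs of sets for the density.\<close>
  define b where "b n = n * exp (- 2 * \<gamma>\<^sup>2 * n) + 4 ^ n * exp (- a * n\<^sup>2)" for n :: nat
  have "0 < a" using p \<epsilon> by (simp add: a_def)
  with pos have "b \<longlonglongrightarrow> 0"
    unfolding b_def by real_asymp
  then have lim: "(\<lambda>n. 1 - b n) \<longlonglongrightarrow> 1"
    by (auto intro!: tendsto_eq_intros)
  let ?good = "\<lambda>n. {E. \<forall>A. orientation_of E A \<longrightarrow> (\<exists>v. seymour_vertex {..<n} A v)}"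
  have bound: "1 - b n \<le> measure_pmf.prob (gnp n p) (?good n)"
    if n: "max 2 (nat \<lceil>1 / \<epsilon>\<rceil>) \<le> n" for n
  proof -
    let ?bad = "high_degree_graphs n (p + \<gamma>) \<union> sparse_pair_graphs n q \<epsilon>"
    have n\<epsilon>: "1 \<le> \<epsilon> * n"
    proof -
      have "1 / \<epsilon> \<le> n" using n by linarith
      then show ?thesis using \<epsilon> by (simp add: field_simps)
    qed
    have "\<exists>v. seymour_vertex {..<n} A v"
      if E: "E \<notin> ?bad" and A: "orientation_of E A" for E A
    proof -
      interpret quasirandom_orientation "{..<n}" E A q \<epsilon>
      proof
        show "q * card S * card T \<le> card {(s, t) \<in> S \<times> T. {s, t} \<in> E}"
          if "S \<subseteq> {..<n}" "T \<subseteq> {..<n}" "S \<inter> T = {}"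
            "\<epsilon> * card {..<n} \<le> card S" "\<epsilon> * card {..<n} \<le> card T" for S T
          using E that by (force simp: sparse_pair_graphs_def not_less)
      qed (use A pos n\<epsilon> in auto)
      have "card (out_nbhd {..<n} A v) \<le> (1 / 2 - \<gamma>) * card {..<n}" if "v \<in> {..<n}" for v
      proof -
        have "card (out_nbhd {..<n} A v) \<le> card {w \<in> {..<n}. w \<noteq> v \<and> {v, w} \<in> E}"
          using out_nbhd_subset_nbhd[OF A] by (intro card_mono) auto
        moreover have "card {w \<in> {..<n}. w \<noteq> v \<and> {v, w} \<in> E} \<le> (p + \<gamma>) * n"
          using E that by (force simp: high_degree_graphs_def not_less)
        ultimately show ?thesis using pos by simp
      qed
      then show ?thesis
        using pos c_def \<epsilon> K by (intro seymour_vertex_exists) auto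
    qed
    then have "measure_pmf.prob (gnp n p) (UNIV - ?bad) \<le> measure_pmf.prob (gnp n p) (?good n)"
      by (intro measure_pmf.finite_measure_mono) auto
    moreover have "measure_pmf.prob (gnp n p) (UNIV - ?bad) = 1 - measure_pmf.prob (gnp n p) ?bad"
      using measure_pmf.prob_compl[of ?bad "gnp n p"] by simp
    moreover have "measure_pmf.prob (gnp n p) ?bad \<le> b n"
    proof -
      have "measure_pmf.prob (gnp n p) ?bad \<le> measure_pmf.prob (gnp n p) (high_degree_graphs n (p + \<gamma>))
          + measure_pmf.prob (gnp n p) (sparse_pair_graphs n q \<epsilon>)"
        by (rule measure_Un_le) auto
      also have "\<dots> \<le> b n"
        unfolding b_def a_def q_def using p pos \<epsilon> n
        by (intro add_mono prob_high_degree_graphs prob_sparse_pair_graphs) auto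
      finally show ?thesis .
    qed
    ultimately show ?thesis by linarith
  qed
  show ?thesis
  proof (rule tendsto_sandwich[OF _ _ lim tendsto_const])
    show "eventually (\<lambda>n. 1 - b n \<le> measure_pmf.prob (gnp n p) (?good n)) sequentially"
      using bound by (rule eventually_mono[OF eventually_ge_at_top])
  qed auto
qed

end
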